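(* Let $\mathbb{K}$ be a field of characteristic zero and let $B:\mathbb{K}[[x]]\to\mathbb{K}[[x]]$ be the $\mathbb{K}$-linear operator induced by the infinite lower triangular matrix $B=(b_{i,j})_{i,j\ge0}$ with $b_{i,j}=(j+1)!\left\{{i+1\atop j+1}\right\}$, where $\left\{{k\atop l}\right\}$ denotes the Stirling number of the second kind. Then $1$ is an eigenvalue of $B$, and the eigenspace of $B$ associated to the eigenvalue $1$ is $\left\{\frac{c}{1+x} : c\in\mathbb{K}\right\}$.
   Context: The Stirling number of the second kind $\left\{{k\atop l}\right\}$ is the number of partitions of a $k$-element set into $l$ nonempty blocks; in particular it is $0$ for $l>k$. The operator induced by the matrix $B$ acts on coefficient sequences viewed as column vectors: $B\left(\sum_{n\ge0}\zeta_n x^n\right)=\sum_{n\ge0}\eta_n x^n$, where $\eta_i=\sum_{j=0}^{i} b_{i,j}\zeta_j$ for each $i\ge0$. The series $\frac{c}{1+x}$ is $\sum_{n\ge0}(-1)^n c\,x^n$. *)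

theory Defs
  imports
    "HOL-Computational_Algebra.Formal_Power_Series"
    "HOL-Combinatorics.Stirling"
    "HOL-Library.Disjoint_Sets"
begin

text \<open>The library introduces \<^const>\<open>Stirling\<close> by its recurrence; we show that it counts set
  partitions into a given number of blocks.\<close>

lemma card_partitions_eq_Stirling:
  assumes "finite A"
  shows "card {P. partition_on A P \<and> card P = k} = Stirling (card A) k"
  using assms
proof (induction A arbitrary: k rule: finite_induct)
  case empty
  have "{P. partition_on ({} :: 'a set) P \<and> card P = k} = (if k = 0 then {{}} else {})"
    by (auto simp: partition_on_empty)
  then show ?case by (cases k) (simp_all del: Collect_empty_eq)
next
  case (insert a A)
  define S where "S B k = {P. partition_on B P \<and> card P = k}" for B :: "'a set" and k
  have fin: "finite (S B k)" if "finite B" for B k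
    using finitely_many_partition_on[OF that] by (auto simp: S_def)
  have finP: "finite P" if "P \<in> S B k" "finite B" for P B k
    using that finite_elements by (auto simp: S_def)
  show ?case
  proof (cases k)
    case 0
    have "S (insert a A) 0 = {}"
    proof -
      have False if "P \<in> S (insert a A) 0" for P
        using that finP[OF that] insert.hyps by (auto simp: S_def partition_on_def)
      then show ?thesis by blast
    qed
    then show ?thesis using 0 insert.hyps unfolding S_def by (simp del: Collect_empty_eq)
  next
    case (Suc m)
    define F where "F = (\<lambda>(Q, C). insert (insert a C) (Q - {C :: 'a set}))"
    let ?U = "insert {a} ` S A m" and ?V = "F ` (SIGMA Q : S A (Suc m). Q)"
    have nota: "a \<notin> X" if "X \<in> Q" "Q \<in> S A j" for X Q j
      using that insert.hyps by (auto simp: S_def partition_on_def)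
    have U: "?U \<subseteq> S (insert a A) (Suc m)"
    proof
      fix P assume "P \<in> ?U"
      then obtain Q where Q: "Q \<in> S A m" "P = insert {a} Q" by auto
      have "{a} \<notin> Q" using nota[OF _ Q(1)] by blast
      then have "card P = Suc m" using Q finP[OF Q(1)] insert.hyps by (simp add: S_def)
      moreover have "partition_on (insert a A) P"
        using Q insert.hyps unfolding S_def partition_on_def disjoint_def by auto
      ultimately show "P \<in> S (insert a A) (Suc m)" by (simp add: S_def)
    qed
    have V: "?V \<subseteq> S (insert a A) (Suc m)"
    proof
      fix P assume "P \<in> ?V"
      then obtain Q C where Q: "Q \<in> S A (Suc m)" "C \<in> Q" "P = insert (insert a C) (Q - {C})"
        by (auto simp: F_def)
      have fQ: "finite Q" using finP[OF Q(1)] insert.hyps by simp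
      have "insert a C \<notin> Q - {C}" using nota[OF _ Q(1)] by blast
      then have "card P = Suc m" using Q fQ by (simp add: S_def)
      moreover have "partition_on (insert a A) P"
      proof -
        have part: "\<Union>Q = A" "{} \<notin> Q" "\<And>X Y. X \<in> Q \<Longrightarrow> Y \<in> Q \<Longrightarrow> X \<noteq> Y \<Longrightarrow> X \<inter> Y = {}"
          using Q(1) by (auto simp: S_def partition_on_def disjoint_def)
        have "insert a C \<inter> Y = {}" if "Y \<in> Q - {C}" for Y
          using that part(3)[of C Y] Q(2) nota[OF _ Q(1), of Y] by auto
        then have "disjoint P"
          using part(3) unfolding Q(3) disjoint_def by (auto simp: Int_commute)
        moreover have "\<Union>P = insert a A" unfolding Q(3) part(1)[symmetric] using Q(2) by blast
        moreover have "{} \<notin> P" using part(2) Q(3) by auto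
        ultimately show ?thesis by (simp add: partition_on_def)
      qed
      ultimately show "P \<in> S (insert a A) (Suc m)" by (simp add: S_def)
    qed
    have W: "S (insert a A) (Suc m) \<subseteq> ?U \<union> ?V"
    proof
      fix P assume P: "P \<in> S (insert a A) (Suc m)"
      have fP: "finite P" using finP[OF P] insert.hyps by simp
      have part: "\<Union>P = insert a A" "{} \<notin> P"
          "\<And>X Y. X \<in> P \<Longrightarrow> Y \<in> P \<Longrightarrow> X \<noteq> Y \<Longrightarrow> X \<inter> Y = {}" and cP: "card P = Suc m"
        using P by (auto simp: S_def partition_on_def disjoint_def)
      obtain D where D: "D \<in> P" "a \<in> D" using part(1) by blast
      have other: "a \<notin> X" if "X \<in> P - {D}" for X using that part(3)[of X D] D by auto
      have UD: "\<Union>(P - {D}) = A - D"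
      proof -
        have "X \<inter> D = {}" if "X \<in> P - {D}" for X using that part(3)[of X D] D by auto
        then have "\<Union>(P - {D}) = \<Union>P - D" by blast
        then show ?thesis using D(2) part(1) by auto
      qed
      have DA: "D - {a} \<subseteq> A" using part(1) D by blast
      have cPD: "card (P - {D}) = m" using cP D fP by simp
      show "P \<in> ?U \<union> ?V"
      proof (cases "D = {a}")
        case True
        have "\<Union>(P - {D}) = A" using UD True insert.hyps by auto
        then have "partition_on A (P - {D})" 
          using part by (auto simp: partition_on_def disjoint_def)
        then have "P - {D} \<in> S A m" using cPD by (simp add: S_def)
        moreover have "P = insert {a} (P - {D})" using True D by auto
        ultimately show ?thesis by blast
      next
        case False
        define C where "C = D - {a}"
        define Q where "Q = insert C (P - {D})"
        have C0: "C \<noteq> {}" using False D by (auto simp: C_def)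
        have disjC: "C \<inter> X = {}" if "X \<in> P - {D}" for X
          using that part(3)[of X D] D by (auto simp: C_def)
        have Cn: "C \<notin> P - {D}" using disjC[of C] C0 by auto
        have "card Q = Suc m" using Cn cPD fP by (simp add: Q_def)
        moreover have "partition_on A Q"
        proof -
          have "\<Union>Q = A" using UD DA insert.hyps(2) unfolding Q_def C_def by auto
          moreover have "disjoint Q"
            using disjC part(3) unfolding Q_def disjoint_def by (auto simp: Int_commute)
          moreover have "{} \<notin> Q" using C0 part(2) by (auto simp: Q_def)
          ultimately show ?thesis by (simp add: partition_on_def)
        qed
        ultimately have "Q \<in> S A (Suc m)" by (simp add: S_def)
        moreover have "P = F (Q, C)"
        proof -
          have "insert a C = D" using D by (auto simp: C_def)
          moreover have "Q - {C} = P - {D}" using Cn by (simp add: Q_def)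
          ultimately show ?thesis using D by (auto simp: F_def)
        qed
        moreover have "C \<in> Q" by (simp add: Q_def)
        ultimately show ?thesis by blast
      qed
    qed
    have disj: "?U \<inter> ?V = {}"
    proof -
      have False if Q: "Q \<in> S A (Suc m)" "C \<in> Q" and R: "R \<in> S A m"
        and eq: "insert {a} R = insert (insert a C) (Q - {C})" for Q C R
      proof -
        have "{a} \<in> insert (insert a C) (Q - {C})" using eq by blast
        then have "insert a C = {a}" using nota[OF _ Q(1)] by auto
        then have "C = {}" using nota[OF Q(2,1)] by auto
        then show False using Q by (auto simp: S_def partition_on_def)
      qed
      then show ?thesis by (fastforce simp: F_def)
    qed
    have injU: "inj_on (insert {a}) (S A m)"
    proof (rule inj_onI)
      fix Q R assume Q: "Q \<in> S A m" and R: "R \<in> S A m" and e: "insert {a} Q = insert {a} R"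
      have "{a} \<notin> Q" "{a} \<notin> R" using nota[OF _ Q] nota[OF _ R] by blast+
      then show "Q = R" using e by (simp add: insert_ident)
    qed
    have injV: "inj_on F (SIGMA Q : S A (Suc m). Q)"
    proof (rule inj_on_inverseI)
      fix z assume "z \<in> (SIGMA Q : S A (Suc m). Q)"
      then obtain Q C where z: "z = (Q, C)" "Q \<in> S A (Suc m)" "C \<in> Q" by auto
      have n: "a \<notin> X" if "X \<in> Q" for X using nota[OF that z(2)] .
      have "(\<lambda>X. X - {a}) ` F z = insert (C - {a}) ((\<lambda>X. X - {a}) ` (Q - {C}))"
        by (simp add: z F_def)
      also have "(\<lambda>X. X - {a}) ` (Q - {C}) = id ` (Q - {C})"
        by (rule image_cong) (use n in auto)
      also have "insert (C - {a}) (id ` (Q - {C})) = Q" using n z(3) by auto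
      finally have 1: "(\<lambda>X. X - {a}) ` F z = Q" .
      have "{X \<in> F z. a \<in> X} = {insert a C}" using n by (auto simp: z F_def)
      then have 2: "\<Union>{X \<in> F z. a \<in> X} - {a} = C" using n[OF z(3)] by auto
      show "(\<lambda>P. ((\<lambda>X. X - {a}) ` P, \<Union>{X \<in> P. a \<in> X} - {a})) (F z) = z"
        using 1 2 z(1) by simp
    qed
    have fS: "finite (SIGMA Q : S A (Suc m). Q)"
      using fin[OF insert.hyps(1)] finP[OF _ insert.hyps(1)] by auto
    have "card (S (insert a A) (Suc m)) = card (?U \<union> ?V)"
      using U V W by (intro arg_cong[of _ _ card]) blast
    also have "\<dots> = card ?U + card ?V"
      using fin[OF insert.hyps(1)] fS disj by (intro card_Un_disjoint) auto
    also have "card ?U = card (S A m)" by (rule card_image[OF injU])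
    also have "card ?V = card (SIGMA Q : S A (Suc m). Q)" by (rule card_image[OF injV])
    also have "\<dots> = (\<Sum>Q \<in> S A (Suc m). card Q)"
      using fin[OF insert.hyps(1)] finP[OF _ insert.hyps(1)] by (intro card_SigmaI) auto
    also have "\<dots> = (\<Sum>Q \<in> S A (Suc m). Suc m)"
      by (rule sum.cong) (auto simp: S_def)
    also have "\<dots> = Suc m * card (S A (Suc m))" by simp
    finally show ?thesis
      using Suc insert.IH insert.hyps by (simp add: S_def)
  qed
qed

definition fps_scale :: "'a::field \<Rightarrow> 'a fps \<Rightarrow> 'a fps"
  where "fps_scale c f = fps_const c * f"

definition matrix_operator :: "(nat \<Rightarrow> nat \<Rightarrow> 'a::field) \<Rightarrow> 'a fps \<Rightarrow> 'a fps"
  where "matrix_operator b f = Abs_fps (\<lambda>i. \<Sum>j\<le>i. b i j * fps_nth f j)"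

lemma linear_matrix_operator:
  "Vector_Spaces.linear fps_scale fps_scale (matrix_operator b)"
proof unfold_locales
qed (auto simp: fps_scale_def matrix_operator_def fps_eq_iff algebra_simps sum.distrib
       sum_distrib_left)

definition eigenspace :: "('k \<Rightarrow> 'v \<Rightarrow> 'v) \<Rightarrow> ('v \<Rightarrow> 'v) \<Rightarrow> 'k \<Rightarrow> 'v set"
  where "eigenspace scale T c = {v. T v = scale c v}"

definition eigenvalue :: "('k \<Rightarrow> 'v::zero \<Rightarrow> 'v) \<Rightarrow> ('v \<Rightarrow> 'v) \<Rightarrow> 'k \<Rightarrow> bool"
  where "eigenvalue scale T c \<longleftrightarrow> (\<exists>v. v \<noteq> 0 \<and> T v = scale c v)"

definition stirling_matrix :: "nat \<Rightarrow> nat \<Rightarrow> 'a::field_char_0"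
  where "stirling_matrix i j = fact (j + 1) * of_nat (Stirling (i + 1) (j + 1))"

lemma const_over_one_plus_X:
  fixes c :: "'a::field"
  shows "fps_const c / (1 + fps_X) = Abs_fps (\<lambda>n. (-1) ^ n * c)"
proof -
  have "(1 + fps_X) * Abs_fps (\<lambda>n. (-1) ^ n * c) = fps_const c"
  proof (rule fps_ext)
    fix n
    show "fps_nth ((1 + fps_X) * Abs_fps (\<lambda>n. (-1) ^ n * c)) n = fps_nth (fps_const c) n"
      by (cases n) (simp_all add: algebra_simps)
  qed
  moreover have "(1 + fps_X :: 'a fps) \<noteq> 0" by (auto simp: fps_eq_iff intro!: exI[of _ 0])
  ultimately show ?thesis by (metis nonzero_mult_div_cancel_left)
qed

end

theory Submission
  imports Defs
begin

text \<open>The recurrence of the Stirling numbers reads \<open>b\<^sub>i\<^sub>+\<^sub>1\<^sub>,\<^sub>j = (j + 1) (b\<^sub>i\<^sub>,\<^sub>j + b\<^sub>i\<^sub>,\<^sub>j\<^sub>-\<^sub>1)\<close>, so the alternating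
  sum of row \<open>i + 1\<close> collects each entry of row \<open>i\<close> with the coefficient
  \<open>(-1)\<^sup>j ((j + 1) - (j + 2))\<close>: passing to the next row negates the sum, and \<open>1 / (1 + x)\<close> is fixed.
  A fixed vector is determined by its zeroth entry, since \<open>b\<^sub>i\<^sub>,\<^sub>i = (i + 1)! \<noteq> 1\<close> for \<open>i > 0\<close>.\<close>

lemma stirling_matrix_0_right [simp]: "stirling_matrix i 0 = 1"
  by (simp add: stirling_matrix_def del: Stirling.simps)

lemma stirling_matrix_upper [simp]: "i < j \<Longrightarrow> stirling_matrix i j = 0"
  by (simp add: stirling_matrix_def)

lemma stirling_matrix_diag: "stirling_matrix i i = fact (Suc i)"
  by (simp add: stirling_matrix_def del: fact_Suc)

text \<open>The weight \<open>(j + 2)! = (j + 2) * (j + 1)!\<close> supplies the factor that the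
  Stirling recurrence lacks on its second term, so \<open>j + 2\<close> multiplies both.\<close>

lemma stirling_matrix_Suc_Suc:
  "stirling_matrix (Suc i) (Suc j) =
     of_nat (j + 2) * (stirling_matrix i (Suc j) + stirling_matrix i j)"
  by (simp add: stirling_matrix_def algebra_simps)

lemma sum_alternating_stirling_matrix:
  "(\<Sum>j\<le>i. stirling_matrix i j * (-1) ^ j) = ((-1) ^ i :: 'a::field_char_0)"
proof (induction i)
  case 0
  show ?case by simp
next
  case (Suc i)
  let ?b = "stirling_matrix :: nat \<Rightarrow> nat \<Rightarrow> 'a"
  \<comment> \<open>The recurrence does not reach column 0. Its entries are all 1, so the split-off
    term can be written \<open>?b i 0\<close>, which is the missing first term of the shifted
    sum.\<close>
  have "(\<Sum>j\<le>Suc i. ?b (Suc i) j * (-1) ^ j) =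
      (?b i 0 + (\<Sum>j\<le>i. of_nat (Suc j + 1) * ?b i (Suc j) * (-1) ^ Suc j))
      - (\<Sum>j\<le>i. of_nat (j + 2) * ?b i j * (-1) ^ j)"
    by (subst sum.atMost_Suc_shift)
      (simp add: stirling_matrix_Suc_Suc algebra_simps sum.distrib sum_subtractf sum_negf)
  also have "?b i 0 + (\<Sum>j\<le>i. of_nat (Suc j + 1) * ?b i (Suc j) * (-1) ^ Suc j)
      = (\<Sum>j\<le>Suc i. of_nat (j + 1) * ?b i j * (-1) ^ j)"
    by (subst sum.atMost_Suc_shift) simp
  \<comment> \<open>The top term lies above the diagonal and vanishes.\<close>
  also have "\<dots> = (\<Sum>j\<le>i. of_nat (j + 1) * ?b i j * (-1) ^ j)"
    by simp
  also have "\<dots> - (\<Sum>j\<le>i. of_nat (j + 2) * ?b i j * (-1) ^ j) = - (\<Sum>j\<le>i. ?b i j * (-1) ^ j)"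
    by (simp add: sum_subtractf [symmetric] sum_negf [symmetric] algebra_simps)
  finally show ?case using Suc.IH by simp
qed

text \<open>Strong induction: once all earlier coefficients agree, row \<open>n\<close> of the two
  fixed-point equations leaves \<open>d = b n n * d\<close> for the difference \<open>d\<close> of
  the coefficients at \<open>n\<close>.\<close>

lemma matrix_operator_fixed_eqI:
  fixes f g :: "'a::field fps"
  assumes diag: "\<And>i. i > 0 \<Longrightarrow> b i i \<noteq> 1"
    and f: "matrix_operator b f = f" and g: "matrix_operator b g = g"
    and zero: "fps_nth f 0 = fps_nth g 0"
  shows "f = g"
proof (rule fps_ext)
  fix n
  show "fps_nth f n = fps_nth g n"
  proof (induction n rule: less_induct)
    case (less n)
    show ?case
    proof (cases "n = 0")
      case False
      have row: "fps_nth h n = (\<Sum>j<n. b n j * fps_nth h j) + b n n * fps_nth h n"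
        if "matrix_operator b h = h" for h
      proof -
        have "fps_nth h n = fps_nth (matrix_operator b h) n"
          using that by simp
        then show ?thesis
          by (simp add: matrix_operator_def flip: lessThan_Suc_atMost)
      qed
      have "(\<Sum>j<n. b n j * fps_nth f j) = (\<Sum>j<n. b n j * fps_nth g j)"
        using less by (intro sum.cong) auto
      then have "fps_nth f n - fps_nth g n = b n n * (fps_nth f n - fps_nth g n)"
        by (subst (1) row [OF f], subst (1) row [OF g]) (simp add: right_diff_distrib)
      then have "(1 - b n n) * (fps_nth f n - fps_nth g n) = 0"
        by (simp add: left_diff_distrib)
      then show ?thesis
        using diag False by simp
    qed (simp add: zero)
  qed
qed

theorem proposition6:
  fixes B :: "'a::field_char_0 fps \<Rightarrow> 'a fps"
  defines "B \<equiv> matrix_operator stirling_matrix"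
  shows "eigenvalue fps_scale B 1 \<and>
         eigenspace fps_scale B 1 = {fps_const c / (1 + fps_X) | c. True}"
proof -
  have scale: "fps_scale 1 f = f" for f :: "'a fps"
    by (simp add: fps_scale_def)
  have fixed: "B (fps_const c / (1 + fps_X)) = fps_const c / (1 + fps_X)" for c
    by (simp add: B_def const_over_one_plus_X matrix_operator_def fps_eq_iff
        sum_alternating_stirling_matrix flip: mult.assoc sum_distrib_right)
  have diag: "stirling_matrix i i \<noteq> (1 :: 'a)" if "i > 0" for i
  proof -
    \<comment> \<open>Over the naturals the factorial is at least \<open>Suc i\<close>, hence at
      least 2; characteristic zero carries this over to the field.\<close>
    have "fact (Suc i) \<noteq> (1 :: nat)"
      using fact_ge_self [of "Suc i"] that by linarith
    then have "of_nat (fact (Suc i)) \<noteq> (1 :: 'a)"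
      by (simp only: of_nat_eq_1_iff not_False_eq_True)
    then show ?thesis
      by (simp only: stirling_matrix_diag of_nat_fact not_False_eq_True)
  qed
  \<comment> \<open>The series \<open>c / (1 + x)\<close> has constant coefficient \<open>c\<close>,
    which dictates the choice of \<open>c\<close>.\<close>
  have unique: "f = fps_const (fps_nth f 0) / (1 + fps_X)" if "B f = f" for f
    using diag that fixed unfolding B_def
    by (rule matrix_operator_fixed_eqI) (simp_all add: const_over_one_plus_X)
  have "fps_const 1 / (1 + fps_X) \<noteq> (0 :: 'a fps)"
    unfolding const_over_one_plus_X by (auto simp: fps_eq_iff)
  then have "eigenvalue fps_scale B 1"
    using fixed unfolding eigenvalue_def scale by blast
  moreover have "eigenspace fps_scale B 1 = {fps_const c / (1 + fps_X) | c. True}"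
    using fixed unique unfolding eigenspace_def scale by blast
  ultimately show ?thesis ..
qed

end
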